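(* Let $a$ be a real number with $a\ne -1,-2,\dots$ and let $s\in\mathbb{N}$, $s\ge2$. Then \begin{align*} \frac32\sum_{n=1}^\infty\frac{H_n^2-\zeta_n(2)}{(n+a)^s} &=s\sum_{n=1}^\infty\frac{H_n}{(n+a)^{s+1}}+\sum_{n=1}^\infty\frac{H_n}{n(n+a)^s}-\sum_{j=2}^{s-1}\left(\sum_{n=1}^\infty\frac{H_n}{(n+a)^j}\right)\zeta(s+1-j,a+1)\\ &\quad+a\left(\sum_{n=1}^\infty\frac{H_n}{(n+a)^s}\right)\left(\sum_{n=1}^\infty\frac{1}{n(n+a)}\right)+a\,\zeta(s,a+1)\left(\sum_{n=1}^\infty\frac{H_n}{n(n+a)}\right). \end{align*}
   Context: $H_n=\sum_{j=1}^n\frac1j$, $\zeta_n(2)=\sum_{j=1}^n\frac1{j^2}$, and $\zeta(s,a+1)=\sum_{n=1}^\infty\frac{1}{(n+a)^s}$ is the Hurwitz zeta function. Empty sums are zero. *)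

theory Defs
  imports "HOL-Analysis.Analysis"
begin

definition zeta_partial :: "nat \<Rightarrow> nat \<Rightarrow> real" where
  "zeta_partial n k = (\<Sum>j=1..n. 1 / real j ^ k)"

text \<open>
  The Hurwitz zeta function at an integer first argument, with the usual
  normalisation starting at index 0; thus \<open>hurwitz_zeta s (a + 1)\<close> is the sum of
  \<open>1 / (n + a) ^ s\<close> over \<open>n \<ge> 1\<close>.
\<close>
definition hurwitz_zeta :: "nat \<Rightarrow> real \<Rightarrow> real" where
  "hurwitz_zeta s x = (\<Sum>m. 1 / (real m + x) ^ s)"

text \<open>The sum of \<open>f n\<close> over \<open>n \<ge> 1\<close>, in order of increasing \<open>n\<close>.\<close>
abbreviation suminf1 :: "(nat \<Rightarrow> real) \<Rightarrow> real" (binder \<open>\<Sum>\<^sub>1\<close> 10) where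
  "suminf1 f \<equiv> (\<Sum>m. f (Suc m))"

end

theory Submission
  imports Defs "HOL-Real_Asymp.Real_Asymp"
begin

text \<open>
  Put \<open>u n = 1 / (n + a)\<close> and truncate every sum on the right at \<open>N\<close>. The geometric sum
  over \<open>j\<close> collapses by the partial fraction identity for \<open>u n * u m\<close>, and the truncated
  right-hand side becomes a single sum of \<open>coeff N k * u k ^ s\<close> over \<open>k \<le> N\<close>, where \<open>coeff N k\<close> does
  not depend on \<open>a\<close> or \<open>s\<close>. It differs from \<open>3 / 2 * ((harm k)\<^sup>2 - zeta_partial k 2)\<close> by at most
  \<open>3 * harm N * k / (N + 1 - k)\<close>, so the total error is of order \<open>(harm N)\<^sup>2 / N\<close>. Working with
  finite sums avoids interchanging conditionally convergent double series.
\<close>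

section \<open>Finite sums of harmonic numbers\<close>

lemma zeta_partial_Suc: "zeta_partial (Suc n) k = zeta_partial n k + 1 / real (Suc n) ^ k"
  by (simp add: zeta_partial_def)

lemma harm_Suc_real: "(harm (Suc n) :: real) = harm n + 1 / real (Suc n)"
  by (simp add: harm_Suc inverse_eq_divide)

text \<open>Symmetry of \<open>1 / (j * n)\<close>: the triangle \<open>j \<le> n\<close>, doubled,
  covers the square once and its diagonal a second time.\<close>

lemma sum_harm_over: "(\<Sum>n=1..N. harm n / real n) = ((harm N)\<^sup>2 + zeta_partial N 2) / 2"
proof (induction N)
  case 0
  then show ?case by (simp add: harm_def zeta_partial_def)
next
  case (Suc N)
  define x where "x = 1 / real (Suc N)"
  have "harm (Suc N) / real (Suc N) = (harm N + x) * x" "harm (Suc N) = harm N + x"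
    "zeta_partial (Suc N) 2 = zeta_partial N 2 + x\<^sup>2"
    by (simp_all add: harm_Suc_real zeta_partial_Suc x_def power_one_over del: of_nat_Suc)
  with Suc show ?case
    by (simp add: algebra_simps power2_eq_square add_divide_distrib)
qed

lemma sum_rev: "(\<Sum>n=1..k. f n) = (\<Sum>n=1..k. f (Suc k - n))" for f :: "nat \<Rightarrow> real"
  by (rule sum.reindex_bij_witness[of _ "\<lambda>n. Suc k - n" "\<lambda>n. Suc k - n"]) auto

lemma sum_inverse_mult_reflect:
  "(\<Sum>n=1..k. 1 / (real n * real (Suc k - n))) = 2 * harm k / real (Suc k)"
proof -
  have "(\<Sum>n=1..k. 1 / (real n * real (Suc k - n)))
      = (\<Sum>n=1..k. (1 / real n + 1 / real (Suc k - n)) / real (Suc k))"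
  proof (rule sum.cong)
    fix n assume n: "n \<in> {1..k}"
    then have "real n + real (Suc k - n) = real (Suc k)" "real n > 0" "real (Suc k - n) > 0"
      by auto
    then show "1 / (real n * real (Suc k - n)) = (1 / real n + 1 / real (Suc k - n)) / real (Suc k)"
      by (simp add: add_divide_eq_iff divide_add_eq_iff add.commute del: of_nat_Suc)
  qed simp
  also have "\<dots> = ((\<Sum>n=1..k. 1 / real n) + (\<Sum>n=1..k. 1 / real (Suc k - n))) / real (Suc k)"
    by (simp only: sum_divide_distrib[symmetric] sum.distrib)
  also have "(\<Sum>n=1..k. 1 / real (Suc k - n)) = (\<Sum>n=1..k. 1 / real n)"
    by (rule sum_rev[symmetric])
  finally show ?thesis by (simp add: harm_def inverse_eq_divide)
qed

text \<open>This is how the numerator of the left-hand series enters. Raising \<open>k\<close> by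
  one adds \<open>1 / (n * (Suc k - n))\<close> to each term, and by partial fractions these add up
  to \<open>2 * harm k / Suc k\<close>, the increment on the right.\<close>

lemma sum_harm_reflect:
  "(\<Sum>n=1..k. harm (k - n) / real n) = (harm k)\<^sup>2 - zeta_partial k 2"
proof (induction k)
  case 0
  then show ?case by (simp add: harm_def zeta_partial_def)
next
  case (Suc k)
  have "(\<Sum>n=1..Suc k. harm (Suc k - n) / real n) = (\<Sum>n=1..k. harm (Suc k - n) / real n)"
    by (simp add: harm_expand)
  also have "\<dots> = (\<Sum>n=1..k. harm (k - n) / real n + 1 / (real n * real (Suc k - n)))"
    by (rule sum.cong) (auto simp: Suc_diff_le harm_Suc_real add_divide_distrib mult.commute
        simp del: of_nat_Suc)
  also have "\<dots> = (harm k)\<^sup>2 - zeta_partial k 2 + 2 * harm k / real (Suc k)"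
    by (simp only: sum.distrib Suc sum_inverse_mult_reflect)
  also have "\<dots> = (harm (Suc k))\<^sup>2 - zeta_partial (Suc k) 2"
  proof -
    define x where "x = 1 / real (Suc k)"
    have "2 * harm k / real (Suc k) = 2 * harm k * x" "harm (Suc k) = harm k + x"
      "zeta_partial (Suc k) 2 = zeta_partial k 2 + x\<^sup>2"
      by (simp_all add: harm_Suc_real zeta_partial_Suc x_def power_one_over del: of_nat_Suc)
    then show ?thesis by (simp add: algebra_simps power2_eq_square)
  qed
  finally show ?case .
qed

section \<open>Sums with the pole at \<open>n = k\<close> removed\<close>

text \<open>The term \<open>n = k\<close> is \<open>1 / 0 = 0\<close>. Terms below \<open>k\<close>
  reflect to \<open>- harm (k - 1)\<close> and terms above it give \<open>harm M\<close>.\<close>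

lemma sum_punctured_inverse:
  assumes "k \<ge> 1"
  shows "(\<Sum>n=1..k + M. 1 / (real n - real k)) = harm M - harm (k - 1)"
proof (induction M)
  case 0
  obtain l where l: "k = Suc l" using assms by (cases k) auto
  have "(\<Sum>n=1..l. 1 / (real n - real (Suc l))) = (\<Sum>n=1..l. 1 / (real (Suc l - n) - real (Suc l)))"
    by (rule sum_rev)
  also have "\<dots> = (\<Sum>n=1..l. - (1 / real n))"
    by (rule sum.cong) (auto simp: of_nat_diff)
  finally show ?case by (simp add: l harm_def sum_negf inverse_eq_divide)
next
  case (Suc M)
  then show ?case by (simp add: harm_Suc_real)
qed

lemma harm_add: "(harm (M + k) :: real) = harm M + (\<Sum>i=1..k. 1 / real (M + i))"
  by (induction k) (auto simp: harm_Suc_real)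

text \<open>Terms below \<open>k\<close> reflect to \<open>sum_harm_reflect\<close>. Above
  \<open>k\<close>, the excess of \<open>harm (k + m) / m\<close> over \<open>harm m / m\<close> is
  the sum of \<open>1 / (m * (m + i))\<close> over \<open>i \<le> k\<close>; summing over
  \<open>m \<le> M\<close> by partial fractions gives the middle sum, which vanishes at
  \<open>M = 0\<close>.\<close>

lemma sum_punctured_harm:
  assumes "k \<ge> 1"
  shows "(\<Sum>n=1..k + M. harm n / (real n - real k)) =
    (\<Sum>n=1..M. harm n / real n) + (\<Sum>i=1..k. (harm i + harm M - harm (M + i)) / real i)
    - ((harm k)\<^sup>2 - zeta_partial k 2)"
proof (induction M)
  case 0
  obtain l where l: "k = Suc l" using assms by (cases k) auto
  have "(\<Sum>n=1..l. harm n / (real n - real (Suc l)))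
      = (\<Sum>n=1..l. harm (Suc l - n) / (real (Suc l - n) - real (Suc l)))"
    by (rule sum_rev)
  also have "\<dots> = (\<Sum>n=1..l. - (harm (Suc l - n) / real n))"
    by (rule sum.cong) (auto simp: of_nat_diff)
  also have "\<dots> = - (\<Sum>n=1..Suc l. harm (Suc l - n) / real n)"
    by (simp add: sum_negf harm_expand)
  also note sum_harm_reflect
  finally show ?case by (simp add: l harm_expand)
next
  case (Suc M)
  \<comment> \<open>The increment of the middle sum must be the gap between the new terms
    \<open>harm (Suc M + k) / Suc M\<close> and \<open>harm (Suc M) / Suc M\<close>.\<close>
  have "(\<Sum>i=1..k. (harm i + harm (Suc M) - harm (Suc M + i)) / real i)
      = (\<Sum>i=1..k. (harm i + harm M - harm (M + i)) / real i + 1 / real (Suc M + i) / real (Suc M))"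
  proof (rule sum.cong)
    fix i assume "i \<in> {1..k}"
    then have "(1 / real (Suc M) - 1 / (real (Suc M) + real i)) / real i
        = 1 / (real (Suc M) + real i) / real (Suc M)"
      by (simp add: diff_frac_eq del: of_nat_Suc)
    then show "(harm i + harm (Suc M) - harm (Suc M + i)) / real i
        = (harm i + harm M - harm (M + i)) / real i + 1 / real (Suc M + i) / real (Suc M)"
      by (simp add: harm_Suc_real add_divide_distrib diff_divide_distrib add.assoc)
  qed simp
  also have "\<dots> = (\<Sum>i=1..k. (harm i + harm M - harm (M + i)) / real i)
      + (harm (Suc M + k) - harm (Suc M)) / real (Suc M)"
    by (simp only: harm_add sum.distrib) (simp add: sum_divide_distrib)
  finally show ?case
    using Suc by (simp add: add_ac diff_divide_distrib)
qed

section \<open>Harmonic bounds and the coefficients of the truncated sum\<close>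

lemma harm_add_diff_le: "(harm (M + k) :: real) - harm M \<le> real k / real (Suc M)"
proof -
  have "(\<Sum>i=1..k. 1 / real (M + i)) \<le> real (card {1..k}) * (1 / real (Suc M))"
    by (rule sum_bounded_above) (auto simp: field_simps)
  then show ?thesis by (simp add: harm_add)
qed

lemma harm_mono_real: "m \<le> n \<Longrightarrow> (harm m :: real) \<le> harm n"
  by (rule harm_mono)

lemma harm_le_ln:
  assumes "n > 0"
  shows "(harm n :: real) \<le> ln (real n) + 1"
  \<comment> \<open>The decreasing sequence starts at \<open>harm 1 - ln 1 = 1\<close>, hence the
    index \<open>n - 1\<close>.\<close>
  using assms decseqD[OF decseq_harm_diff_ln, of 0 "n - 1"] by (simp add: harm_expand)

lemma harm_ge_1: "n \<ge> 1 \<Longrightarrow> (harm n :: real) \<ge> 1"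
  using harm_mono_real[of 1 n] by (simp add: harm_expand)

text \<open>The coefficient of \<open>1 / (k + a) ^ s\<close> in the truncated right-hand side; the
  poles at \<open>m = k\<close> and \<open>n = k\<close> contribute nothing because \<open>1 / 0 = 0\<close>.\<close>
definition coeff :: "nat \<Rightarrow> nat \<Rightarrow> real" where
  "coeff N k = harm k / real k + harm k * (\<Sum>m=1..N. 1 / real m - 1 / (real m - real k))
    + (\<Sum>n=1..N. harm n * (1 / real n + 1 / (real k - real n)))"

text \<open>The factor \<open>3 / 2\<close> is assembled from \<open>(harm k)\<^sup>2\<close>, the
  reflected sum \<open>(harm k)\<^sup>2 - zeta_partial k 2\<close>, and minus half of
  \<open>(harm k)\<^sup>2 + zeta_partial k 2\<close>. The other three terms tend to 0 as
  \<open>M\<close> grows with \<open>k\<close> fixed.\<close>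

lemma coeff_eq:
  assumes "k \<ge> 1"
  shows "coeff (k + M) k = 3 / 2 * ((harm k)\<^sup>2 - zeta_partial k 2)
    + harm k * (harm (M + k) - harm M) + (\<Sum>i=1..k. harm (M + i) / real (M + i))
    + (\<Sum>i=1..k. (harm (M + i) - harm M) / real i)"
proof -
  \<comment> \<open>The trailing \<open>- 1 / k\<close> comes from \<open>harm (k - 1)\<close> and
    cancels the summand \<open>harm k / k\<close> of \<open>coeff\<close>.\<close>
  have 1: "(\<Sum>m=1..k + M. 1 / real m - 1 / (real m - real k))
      = harm (M + k) - harm M + harm k - 1 / real k"
  proof -
    have "harm k = harm (k - 1) + 1 / real k"
      using assms by (cases k) (auto simp: harm_Suc_real)
    then show ?thesis
      by (simp only: sum_subtractf sum_punctured_inverse[OF assms])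
        (simp add: harm_def inverse_eq_divide add.commute)
  qed
  have "harm n * (1 / real n + 1 / (real k - real n)) = harm n / real n - harm n / (real n - real k)" for n
  proof -
    have "1 / (real k - real n) = - (1 / (real n - real k))"
      by (metis minus_diff_eq minus_divide_right)
    then show ?thesis by (simp only:) (simp add: algebra_simps)
  qed
  then have 2: "(\<Sum>n=1..k + M. harm n * (1 / real n + 1 / (real k - real n)))
      = (\<Sum>n=1..k + M. harm n / real n) - (\<Sum>n=1..k + M. harm n / (real n - real k))"
    by (simp add: sum_subtractf)
  have 3: "(\<Sum>n=1..k + M. harm n / real n)
      = (\<Sum>n=1..M. harm n / real n) + (\<Sum>i=1..k. harm (M + i) / real (M + i))" for k
    by (induction k) (auto simp: ac_simps)
  have 4: "(\<Sum>i=1..k. (harm i + harm M - harm (M + i)) / real i)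
      = (\<Sum>i=1..k. harm i / real i) - (\<Sum>i=1..k. (harm (M + i) - harm M) / real i)"
    by (simp only: sum_subtractf[symmetric])
       (rule sum.cong, auto simp: add_divide_distrib diff_divide_distrib)
  show ?thesis
    unfolding coeff_def 1 2 3 sum_punctured_harm[OF assms] 4 sum_harm_over[of k]
    by (simp add: field_simps power2_eq_square)
qed

text \<open>The three remainder terms of \<open>coeff_eq\<close> are nonnegative, and each is at
  most \<open>harm N * k / (N + 1 - k)\<close>; hence the constant 3.\<close>

lemma coeff_error:
  assumes "1 \<le> k" "k \<le> N"
  shows "\<bar>coeff N k - 3 / 2 * ((harm k)\<^sup>2 - zeta_partial k 2)\<bar> \<le> 3 * harm N * real k / real (Suc N - k)"
proof -
  define M where "M = N - k"
  have N: "N = k + M" using assms by (simp add: M_def)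
  have SM: "Suc N - k = Suc M" by (simp add: N)
  let ?A = "harm k * (harm (M + k) - harm M) :: real"
  let ?B = "\<Sum>i=1..k. harm (M + i) / real (M + i)"
  let ?C = "\<Sum>i=1..k. (harm (M + i) - harm M) / real i"
  let ?D = "harm N * (real k / real (Suc M))"
  have H0: "0 \<le> (harm n :: real)" for n by (rule harm_nonneg)
  have "0 \<le> ?A" "0 \<le> ?B" "0 \<le> ?C"
    by (auto intro!: sum_nonneg mult_nonneg_nonneg divide_nonneg_nonneg H0 simp: harm_mono_real)
  moreover have "?A \<le> ?D"
    using harm_add_diff_le[of M k] harm_mono_real[of M "M + k"]
    by (intro mult_mono) (auto simp: N harm_mono_real H0)
  moreover have "?B \<le> ?D"
  proof -
    have "?B \<le> real (card {1..k}) * (harm N / real (Suc M))"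
      by (rule sum_bounded_above) (auto simp: N intro!: frac_le harm_mono_real H0)
    then show ?thesis by (simp add: mult.commute)
  qed
  moreover have "?C \<le> ?D"
  proof -
    have "?C \<le> real (card {1..k}) * (1 / real (Suc M))"
    proof (rule sum_bounded_above)
      fix i assume "i \<in> {1..k}"
      then show "(harm (M + i) - harm M) / real i \<le> 1 / real (Suc M)"
        using harm_add_diff_le[of M i] by (simp add: field_simps)
    qed
    \<comment> \<open>No harmonic factor arises here; \<open>harm N \<ge> 1\<close> supplies it to
      match the other two bounds.\<close>
    also have "\<dots> \<le> ?D"
      using harm_ge_1[of N] assms mult_right_mono[of 1 "harm N :: real" "real k / real (Suc M)"]
      by simp
    finally show ?thesis .
  qed
  ultimately show ?thesis
    unfolding SM coeff_eq[OF assms(1), of M, folded N] by (simp only: abs_le_iff) argo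
qed

section \<open>The exact identity for truncated sums\<close>

text \<open>Used with \<open>u = 1 / (n + a)\<close>, \<open>v = 1 / (m + a)\<close> and
  \<open>d = 1 / (m - n)\<close>. The hypothesis gives \<open>v * d = u * (d - v)\<close>, which
  carries the closed form from \<open>s\<close> to \<open>s + 1\<close> without dividing by
  \<open>u - v\<close>.\<close>

lemma geometric_partial_fractions:
  fixes u v d :: real
  assumes "(u - v) * d = u * v" "s \<ge> 2"
  shows "(\<Sum>j=2..s - 1. u ^ j * v ^ (s + 1 - j)) = u ^ s * (d - v) - v ^ s * (u + d)"
  using assms(2)
proof (induction s rule: dec_induct)
  case base
  \<comment> \<open>For \<open>s = 2\<close> the sum is empty, and this says that the right side
    vanishes.\<close>
  have "(u - v) * d * (u + v) = u * v * (u + v)" using assms(1) by simp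
  then show ?case by (simp add: algebra_simps power2_eq_square)
next
  case (step s)
  have "(\<Sum>j=2..Suc s - 1. u ^ j * v ^ (Suc s + 1 - j))
      = (\<Sum>j=2..Suc (s - 1). u ^ j * v ^ (Suc s + 1 - j))"
    using step by simp
  also have "\<dots> = (\<Sum>j=2..s - 1. u ^ j * v ^ (Suc s + 1 - j)) + u ^ s * v\<^sup>2"
    using step by (subst sum.nat_ivl_Suc') (auto simp: numeral_2_eq_2)
  also have "(\<Sum>j=2..s - 1. u ^ j * v ^ (Suc s + 1 - j)) = v * (\<Sum>j=2..s - 1. u ^ j * v ^ (s + 1 - j))"
    unfolding sum_distrib_left by (rule sum.cong) (auto simp: Suc_diff_le)
  also have "\<dots> + u ^ s * v\<^sup>2 = u ^ s * (v * d) - v ^ Suc s * (u + d)"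
    unfolding step.IH by (simp add: algebra_simps power2_eq_square)
  also have "v * d = u * (d - v)"
    using assms(1) by (simp add: algebra_simps)
  finally show ?case by simp
qed

text \<open>Everything but the second sum is expanded over pairs \<open>(n, m)\<close>. Off the
  diagonal the closed form of the geometric sum cancels the mixed terms \<open>u n ^ s * u m\<close>
  and \<open>u m ^ s * u n\<close>; what remains is grouped by the index carrying the power
  \<open>s\<close>.\<close>

lemma truncated_identity:
  fixes u :: "nat \<Rightarrow> real" and H :: "nat \<Rightarrow> real"
  assumes u: "\<And>n m. n \<in> {1..N} \<Longrightarrow> m \<in> {1..N} \<Longrightarrow> n \<noteq> m \<Longrightarrow> (u n - u m) / (real m - real n) = u n * u m"
    and s: "s \<ge> 2"
  shows "real s * (\<Sum>n=1..N. H n * u n ^ (s + 1)) + (\<Sum>n=1..N. H n / real n * u n ^ s)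
      - (\<Sum>j=2..s - 1. (\<Sum>n=1..N. H n * u n ^ j) * (\<Sum>n=1..N. u n ^ (s + 1 - j)))
      + (\<Sum>n=1..N. H n * u n ^ s) * (\<Sum>n=1..N. 1 / real n - u n)
      + (\<Sum>n=1..N. u n ^ s) * (\<Sum>n=1..N. H n * (1 / real n - u n))
    = (\<Sum>k=1..N. u k ^ s * (H k / real k + H k * (\<Sum>m=1..N. 1 / real m - 1 / (real m - real k))
        + (\<Sum>n=1..N. H n * (1 / real n + 1 / (real k - real n)))))"
    (is "?X + ?Y - ?G + ?P + ?Q = ?R")
proof -
  let ?g = "\<lambda>n m. 1 / (real m - real n)"
  let ?A = "(\<Sum>n=1..N. \<Sum>m=1..N. H n * (u n ^ s * (1 / real m - ?g n m)))"
  let ?B = "(\<Sum>m=1..N. \<Sum>n=1..N. H n * (u m ^ s * (1 / real n + ?g n m)))"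
  have G: "?G = (\<Sum>n=1..N. \<Sum>m=1..N. H n * (\<Sum>j=2..s - 1. u n ^ j * u m ^ (s + 1 - j)))"
  proof -
    have "?G = (\<Sum>j=2..s - 1. \<Sum>n=1..N. \<Sum>m=1..N. H n * (u n ^ j * u m ^ (s + 1 - j)))"
      unfolding sum_product by (simp add: mult_ac)
    also have "\<dots> = (\<Sum>n=1..N. \<Sum>j=2..s - 1. \<Sum>m=1..N. H n * (u n ^ j * u m ^ (s + 1 - j)))"
      by (rule sum.swap)
    also have "\<dots> = (\<Sum>n=1..N. \<Sum>m=1..N. \<Sum>j=2..s - 1. H n * (u n ^ j * u m ^ (s + 1 - j)))"
      by (intro sum.cong refl sum.swap)
    finally show ?thesis by (simp only: sum_distrib_left)
  qed
  have P: "?P = (\<Sum>n=1..N. \<Sum>m=1..N. H n * (u n ^ s * (1 / real m - u m)))"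
    unfolding sum_product by (simp add: mult_ac)
  have Q: "?Q = (\<Sum>n=1..N. \<Sum>m=1..N. H n * (u m ^ s * (1 / real n - u n)))"
    unfolding sum_product by (subst sum.swap) (simp add: mult_ac)
  have X: "?X = (\<Sum>n=1..N. \<Sum>m=1..N. if m = n then real s * (H n * u n ^ (s + 1)) else 0)"
    by (simp add: sum_distrib_left)
  have "?X - ?G + ?P + ?Q = (\<Sum>n=1..N. \<Sum>m=1..N. H n * (u n ^ s * (1 / real m - ?g n m))
      + H n * (u m ^ s * (1 / real n + ?g n m)))"
    unfolding X G P Q sum_subtractf[symmetric] sum.distrib[symmetric]
  proof (intro sum.cong refl)
    fix n m assume nm: "n \<in> {1..N}" "m \<in> {1..N}"
    show "(if m = n then real s * (H n * u n ^ (s + 1)) else 0)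
        - H n * (\<Sum>j=2..s - 1. u n ^ j * u m ^ (s + 1 - j))
        + H n * (u n ^ s * (1 / real m - u m)) + H n * (u m ^ s * (1 / real n - u n))
      = H n * (u n ^ s * (1 / real m - ?g n m)) + H n * (u m ^ s * (1 / real n + ?g n m))"
    proof (cases "m = n")
      case True
      \<comment> \<open>On the diagonal \<open>s - 2\<close> equal terms from the geometric sum and
        two from the last two products cancel the factor \<open>s\<close>;
        \<open>?g n n = 1 / 0 = 0\<close>.\<close>
      have "(\<Sum>j=2..s - 1. u n ^ j * u n ^ (s + 1 - j)) = (\<Sum>j=2..s - 1. u n ^ (s + 1))"
        by (rule sum.cong) (auto simp flip: power_add)
      also have "\<dots> = (real s - 2) * u n ^ (s + 1)"
        using s by (simp add: of_nat_diff)
      finally have D: "(\<Sum>j=2..s - 1. u n ^ j * u n ^ (s + 1 - j)) = (real s - 2) * u n ^ (s + 1)" .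
      show ?thesis unfolding True D by (simp add: algebra_simps)
    next
      case False
      have "(\<Sum>j=2..s - 1. u n ^ j * u m ^ (s + 1 - j))
          = u n ^ s * (?g n m - u m) - u m ^ s * (u n + ?g n m)"
        using u[OF nm] False s by (intro geometric_partial_fractions) auto
      then show ?thesis using False by (simp only: if_False) (simp add: algebra_simps)
    qed
  qed
  also have "\<dots> = (\<Sum>n=1..N. \<Sum>m=1..N. H n * (u n ^ s * (1 / real m - ?g n m)))
      + (\<Sum>n=1..N. \<Sum>m=1..N. H n * (u m ^ s * (1 / real n + ?g n m)))"
    by (simp only: sum.distrib)
  also have "(\<Sum>n=1..N. \<Sum>m=1..N. H n * (u m ^ s * (1 / real n + ?g n m)))
      = (\<Sum>m=1..N. \<Sum>n=1..N. H n * (u m ^ s * (1 / real n + ?g n m)))"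
    by (rule sum.swap)
  finally have "?X - ?G + ?P + ?Q = ?A + ?B" .
  moreover have "?R = ?Y + (?A + ?B)"
  proof -
    have "?A = (\<Sum>k=1..N. u k ^ s * (H k * (\<Sum>m=1..N. 1 / real m - ?g k m)))"
      by (simp add: sum_distrib_left mult.left_commute)
    moreover have "?B = (\<Sum>k=1..N. u k ^ s * (\<Sum>n=1..N. H n * (1 / real n + ?g n k)))"
      by (simp add: sum_distrib_left mult.left_commute)
    ultimately show ?thesis
      by (simp add: distrib_left sum.distrib mult_ac)
  qed
  ultimately show ?thesis by simp
qed

section \<open>Decay and domination estimates\<close>

lemma harm_sq_over_tendsto: "(\<lambda>N. (harm N)\<^sup>2 / real (Suc N)) \<longlonglongrightarrow> 0"
proof (rule tendsto_sandwich[of "\<lambda>_. 0"])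
  show "\<forall>\<^sub>F N in sequentially. (harm N)\<^sup>2 / real (Suc N) \<le> (ln (real N) + 1)\<^sup>2 / real (Suc N)"
    using eventually_gt_at_top[of 0]
    by eventually_elim (auto intro!: divide_right_mono power_mono harm_nonneg harm_le_ln)
  show "(\<lambda>N. (ln (real N) + 1)\<^sup>2 / real (Suc N)) \<longlonglongrightarrow> 0"
    by real_asymp
qed (auto intro!: always_eventually)

lemma summable_harm_over_sq: "summable (\<lambda>n. harm n / (real n)\<^sup>2 :: real)"
proof (rule summable_comparison_test_ev)
  show "\<forall>\<^sub>F n in sequentially. norm (harm n / (real n)\<^sup>2 :: real) \<le> (ln (real n) + 1) / (real n)\<^sup>2"
    using eventually_gt_at_top[of 0]
    by eventually_elim (auto intro!: divide_right_mono harm_le_ln)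
  show "summable (\<lambda>n. (ln (real n) + 1) / (real n)\<^sup>2)"
  proof (rule summable_comparison_test_bigo)
    \<comment> \<open>Any exponent strictly between -2 and -1 absorbs the logarithm and stays
      summable.\<close>
    show "summable (\<lambda>n. norm (real n powr (-3/2)))"
      by (simp add: summable_real_powr_iff)
    show "(\<lambda>n. (ln (real n) + 1) / (real n)\<^sup>2) \<in> O(\<lambda>n. real n powr (-3/2))"
      by real_asymp
  qed
qed

text \<open>A single majorant serves every series on the right-hand side, with or without a harmonic
  factor.\<close>

lemma dominated_partial_sums:
  fixes f :: "nat \<Rightarrow> real"
  assumes "\<And>n. n \<ge> 1 \<Longrightarrow> \<bar>f n\<bar> \<le> C * (harm n / (real n)\<^sup>2)"
  shows "(\<lambda>N. \<Sum>n=1..N. f n) \<longlonglongrightarrow> (\<Sum>\<^sub>1 n. f n)"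
proof -
  have *: "summable (\<lambda>m. f (Suc m))"
  proof (rule summable_comparison_test)
    show "\<exists>N. \<forall>m\<ge>N. norm (f (Suc m)) \<le> C * (harm (Suc m) / (real (Suc m))\<^sup>2)"
      unfolding real_norm_def by (intro exI allI impI assms) simp
    show "summable (\<lambda>m. C * (harm (Suc m) / (real (Suc m))\<^sup>2))"
      by (subst summable_Suc_iff) (intro summable_mult summable_harm_over_sq)
  qed
  show ?thesis
    using summable_LIMSEQ[OF *] by (simp only: One_nat_def sum.atLeast1_atMost_eq)
qed

text \<open>\<open>n / (n + a)\<close> tends to 1, so it is bounded.\<close>

lemma inverse_shift_bound:
  fixes a :: real
  obtains K where "K \<ge> 1" "\<And>n. n \<ge> 1 \<Longrightarrow> \<bar>1 / (real n + a)\<bar> \<le> K / real n"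
proof -
  have "(\<lambda>n. real n * (1 / (real n + a))) \<longlonglongrightarrow> 1"
    by real_asymp
  then have "Bseq (\<lambda>n. real n * (1 / (real n + a)))"
    by (intro convergent_imp_Bseq convergentI)
  then obtain B where "0 < B" and B: "\<forall>n. norm (real n * (1 / (real n + a))) \<le> B"
    by (rule BseqE)
  show thesis
  proof
    fix n :: nat assume "n \<ge> 1"
    then have "\<bar>1 / (real n + a)\<bar> \<le> B / real n"
      using B[rule_format, of n] by (subst pos_le_divide_eq) (simp_all add: abs_mult)
    also have "\<dots> \<le> max 1 B / real n"
      by (rule divide_right_mono) auto
    finally show "\<bar>1 / (real n + a)\<bar> \<le> max 1 B / real n" .
  qed simp
qed

section \<open>Passage to the limit\<close>

theorem theorem3p1:
  fixes a :: real and s :: nat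
  assumes "\<And>k::nat. k \<ge> 1 \<Longrightarrow> a \<noteq> - real k"
    and "s \<ge> 2"
  shows "3 / 2 * (\<Sum>\<^sub>1 n. ((harm n)\<^sup>2 - zeta_partial n 2) / (real n + a) ^ s) =
      real s * (\<Sum>\<^sub>1 n. harm n / (real n + a) ^ (s + 1))
      + (\<Sum>\<^sub>1 n. harm n / (real n * (real n + a) ^ s))
      - (\<Sum>j=2..s-1. (\<Sum>\<^sub>1 n. harm n / (real n + a) ^ j) * hurwitz_zeta (s + 1 - j) (a + 1))
      + a * (\<Sum>\<^sub>1 n. harm n / (real n + a) ^ s) * (\<Sum>\<^sub>1 n. 1 / (real n * (real n + a)))
      + a * hurwitz_zeta s (a + 1) * (\<Sum>\<^sub>1 n. harm n / (real n * (real n + a)))"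
    (is "_ = ?rhs")
proof -
  define u where "u = (\<lambda>n. 1 / (real n + a))"
  have nz: "real n + a \<noteq> 0" if "n \<ge> 1" for n
    using assms(1)[OF that] by linarith
  obtain K where K: "K \<ge> 1" "\<And>n. n \<ge> 1 \<Longrightarrow> \<bar>u n\<bar> \<le> K / real n"
    unfolding u_def using inverse_shift_bound[of a] by blast
  have u_pow: "\<bar>u n ^ j\<bar> \<le> K ^ j / (real n)\<^sup>2" if "n \<ge> 1" "j \<ge> 2" for n j
  proof -
    have "\<bar>u n ^ j\<bar> \<le> (K / real n) ^ j"
      unfolding power_abs by (intro power_mono K that) auto
    also have "\<dots> = K ^ j / real n ^ j" by (simp add: power_divide)
    also have "\<dots> \<le> K ^ j / (real n)\<^sup>2"
      using K that by (intro divide_left_mono power_increasing) auto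
    finally show ?thesis .
  qed
  have harm_dom: "\<bar>harm n * x\<bar> \<le> C * (harm n / (real n)\<^sup>2)"
    if "\<bar>x\<bar> \<le> C / (real n)\<^sup>2" for n x C
    using mult_left_mono[OF that harm_nonneg[of n]] by (simp add: abs_mult mult_ac)
  \<comment> \<open>Terms without a harmonic factor fit the same majorant since
    \<open>harm n \<ge> 1\<close>.\<close>
  have one_dom: "\<bar>x\<bar> \<le> C * (harm n / (real n)\<^sup>2)"
    if "\<bar>x\<bar> \<le> C / (real n)\<^sup>2" "n \<ge> 1" for n x C
    using order.trans[OF that(1)] mult_right_mono[OF harm_ge_1[OF that(2)], of "\<bar>x\<bar>"]
      mult_left_mono[OF that(1) harm_nonneg[of n]] by (simp add: mult_ac)
  have u2: "\<bar>1 / real n * u n\<bar> \<le> K / (real n)\<^sup>2" if "n \<ge> 1" for n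
    using mult_left_mono[OF K(2)[OF that], of "1 / real n"]
    by (simp add: abs_mult power2_eq_square)
  have u3: "\<bar>1 / real n * u n ^ s\<bar> \<le> K ^ s / (real n)\<^sup>2" if "n \<ge> 1" for n
  proof -
    have "\<bar>1 / real n * u n ^ s\<bar> \<le> 1 * (K ^ s / (real n)\<^sup>2)"
      unfolding abs_mult using that u_pow[OF that assms(2)] by (intro mult_mono) auto
    then show ?thesis by simp
  qed
  have S: "(\<lambda>N. \<Sum>n=1..N. harm n * u n ^ j) \<longlonglongrightarrow> (\<Sum>\<^sub>1 n. harm n * u n ^ j)"
    if "j \<ge> 2" for j
    by (intro dominated_partial_sums[of _ "K ^ j"] harm_dom u_pow that)
  have Z: "(\<lambda>N. \<Sum>n=1..N. u n ^ j) \<longlonglongrightarrow> (\<Sum>\<^sub>1 n. u n ^ j)" if "j \<ge> 2" for j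
    by (intro dominated_partial_sums[of _ "K ^ j"] one_dom u_pow that)
  have Y: "(\<lambda>N. \<Sum>n=1..N. harm n * (1 / real n * u n ^ s)) \<longlonglongrightarrow> (\<Sum>\<^sub>1 n. harm n * (1 / real n * u n ^ s))"
    by (intro dominated_partial_sums[of _ "K ^ s"] harm_dom u3)
  have V: "(\<lambda>N. \<Sum>n=1..N. 1 / real n * u n) \<longlonglongrightarrow> (\<Sum>\<^sub>1 n. 1 / real n * u n)"
    by (intro dominated_partial_sums[of _ K] one_dom u2)
  have W: "(\<lambda>N. \<Sum>n=1..N. harm n * (1 / real n * u n)) \<longlonglongrightarrow> (\<Sum>\<^sub>1 n. harm n * (1 / real n * u n))"
    by (intro dominated_partial_sums[of _ K] harm_dom u2)
  \<comment> \<open>The right-hand side with every series cut off at \<open>N\<close>;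
    \<open>?L\<close> is its termwise limit.\<close>
  define R where "R = (\<lambda>N. real s * (\<Sum>n=1..N. harm n * u n ^ (s + 1))
      + (\<Sum>n=1..N. harm n * (1 / real n * u n ^ s))
      - (\<Sum>j=2..s - 1. (\<Sum>n=1..N. harm n * u n ^ j) * (\<Sum>n=1..N. u n ^ (s + 1 - j)))
      + (\<Sum>n=1..N. harm n * u n ^ s) * (a * (\<Sum>n=1..N. 1 / real n * u n))
      + (\<Sum>n=1..N. u n ^ s) * (a * (\<Sum>n=1..N. harm n * (1 / real n * u n))))"
  let ?L = "real s * (\<Sum>\<^sub>1 n. harm n * u n ^ (s + 1))
      + (\<Sum>\<^sub>1 n. harm n * (1 / real n * u n ^ s))
      - (\<Sum>j=2..s - 1. (\<Sum>\<^sub>1 n. harm n * u n ^ j) * (\<Sum>\<^sub>1 n. u n ^ (s + 1 - j)))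
      + (\<Sum>\<^sub>1 n. harm n * u n ^ s) * (a * (\<Sum>\<^sub>1 n. 1 / real n * u n))
      + (\<Sum>\<^sub>1 n. u n ^ s) * (a * (\<Sum>\<^sub>1 n. harm n * (1 / real n * u n)))"
  \<comment> \<open>Index 0 of \<open>hurwitz_zeta\<close> at \<open>a + 1\<close> is the term
    \<open>n = 1\<close>.\<close>
  have "?L = ?rhs"
    by (simp add: u_def hurwitz_zeta_def power_one_over ac_simps)
  \<comment> \<open>All powers of \<open>u\<close> summed without a factor \<open>1 / n\<close> have
    exponent at least 2, since \<open>j \<le> s - 1\<close> gives
    \<open>s + 1 - j \<ge> 2\<close>.\<close>
  moreover have "R \<longlonglongrightarrow> ?L"
    unfolding R_def using assms(2) by (intro tendsto_intros S Z Y V W) auto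
  ultimately have R_lim: "R \<longlonglongrightarrow> ?rhs" by simp
  have R_eq: "R N = (\<Sum>k=1..N. u k ^ s * coeff N k)" for N
  proof -
    \<comment> \<open>This absorbs the factor \<open>a\<close> and brings the last two products into
      the shape of \<open>truncated_identity\<close>.\<close>
    have diff: "a * (1 / real n * u n) = 1 / real n - u n" if "n \<in> {1..N}" for n
      using that nz[of n] by (simp add: u_def diff_frac_eq)
    have "a * (\<Sum>n=1..N. 1 / real n * u n) = (\<Sum>n=1..N. 1 / real n - u n)"
      unfolding sum_distrib_left by (intro sum.cong refl diff)
    moreover have "a * (\<Sum>n=1..N. harm n * (1 / real n * u n)) = (\<Sum>n=1..N. harm n * (1 / real n - u n))"
      unfolding sum_distrib_left
      by (intro sum.cong refl) (simp only: mult.left_commute[of a "harm _"] diff)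
    moreover have "(u n - u m) / (real m - real n) = u n * u m"
      if "n \<in> {1..N}" "m \<in> {1..N}" "n \<noteq> m" for n m
      using that nz[of n] nz[of m] by (simp add: u_def diff_frac_eq)
    note truncated_identity[of N u s harm, OF this assms(2), folded coeff_def]
    ultimately show ?thesis
      unfolding R_def by simp
  qed
  define e where "e = (\<lambda>k. (harm k)\<^sup>2 - zeta_partial k 2 :: real)"
  \<comment> \<open>The bound \<open>K ^ s / k\<^sup>2\<close> on \<open>u k ^ s\<close> turns the
    factor \<open>k\<close> of \<open>coeff_error\<close> into \<open>1 / k\<close>; then
    \<open>sum_inverse_mult_reflect\<close> doubles the constant 3.\<close>
  have "\<bar>R N - (\<Sum>k=1..N. u k ^ s * (3 / 2 * e k))\<bar> \<le> 6 * K ^ s * ((harm N)\<^sup>2 / real (Suc N))" for N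
  proof -
    have "\<bar>R N - (\<Sum>k=1..N. u k ^ s * (3 / 2 * e k))\<bar>
        = \<bar>\<Sum>k=1..N. u k ^ s * (coeff N k - 3 / 2 * e k)\<bar>"
      by (simp only: R_eq sum_subtractf[symmetric] right_diff_distrib)
    also have "\<dots> \<le> (\<Sum>k=1..N. \<bar>u k ^ s * (coeff N k - 3 / 2 * e k)\<bar>)"
      by (rule sum_abs)
    also have "\<dots> \<le> (\<Sum>k=1..N. 3 * K ^ s * harm N * (1 / (real k * real (Suc N - k))))"
    proof (rule sum_mono)
      fix k assume k: "k \<in> {1..N}"
      have "\<bar>u k ^ s * (coeff N k - 3 / 2 * e k)\<bar>
          \<le> K ^ s / (real k)\<^sup>2 * (3 * harm N * real k / real (Suc N - k))"
        unfolding abs_mult e_def using k K(1) assms(2)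
        by (intro mult_mono u_pow coeff_error) auto
      also have "\<dots> = 3 * K ^ s * harm N * (1 / (real k * real (Suc N - k)))"
        using k by (simp add: power2_eq_square)
      finally show "\<bar>u k ^ s * (coeff N k - 3 / 2 * e k)\<bar> \<le> \<dots>" .
    qed
    also have "\<dots> = 6 * K ^ s * ((harm N)\<^sup>2 / real (Suc N))"
      by (simp only: sum_distrib_left[symmetric] sum_inverse_mult_reflect) (simp add: power2_eq_square)
    finally show ?thesis .
  qed
  then have "(\<lambda>N. R N - (\<Sum>k=1..N. u k ^ s * (3 / 2 * e k))) \<longlonglongrightarrow> 0"
    by (intro Lim_null_comparison[OF _ tendsto_mult_right_zero[OF harm_sq_over_tendsto,
        of "6 * K ^ s"]]) auto
  \<comment> \<open>The difference is the partial sum of the left-hand series, so its convergence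
    and its value come together.\<close>
  from tendsto_diff[OF R_lim this]
  have "(\<lambda>m. u (Suc m) ^ s * (3 / 2 * e (Suc m))) sums ?rhs"
    by (simp add: sums_def sum.atLeast1_atMost_eq)
  from sums_mult[OF this, of "2 / 3"]
  have "(\<lambda>m. e (Suc m) / (real (Suc m) + a) ^ s) sums (2 / 3 * ?rhs)"
    by (simp only: u_def power_one_over) simp
  from sums_unique[OF this] show ?thesis
    unfolding e_def by simp
qed

end
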